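(* Let $k\ge 5$ be an integer and let $H$ be a subgraph of the star $K_{1,\lceil (k-1)/2\rceil}$. Then $$\operatorname{bgr}_k(P_5:H)=\operatorname{bgr}_k(K_{1,3}:H)=\lceil \sqrt{k}\rceil.$$
   Context: All graphs are finite, simple and without isolated vertices (in particular $H$ is non-empty). $P_n$ is the path on $n$ vertices. A $k$-edge-coloring of a graph is a map from its edge set onto $\{1,\dots,k\}$ that is exact, i.e. every one of the $k$ colors is used at least once. An edge-colored graph is rainbow if all its edges have distinct colors and monochromatic if all its edges have the same color. For non-empty bipartite graphs $G,H$ and a positive integer $k$, the bipartite Gallai-Ramsey number $\operatorname{bgr}_k(G:H)$ is the minimum integer $N$ such that for all $n\ge N$, every (exact) $k$-edge-coloring of the complete bipartite graph $K_{n,n}$ contains a rainbow subgraph isomorphic to $G$ or a monochromatic subgraph isomorphic to $H$.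
   Formalization: In the definition of bgr_k, N is also required to be such that K_{n,n} has an exact k-edge-coloring for every n ≥ N; read literally, the condition holds vacuously when n² < k, and the minimum would be at most 1 rather than ⌈√k⌉. *)

theory Defs
  imports Complex_Main "HOL-Library.Extended_Nat"
begin

type_synonym 'a graph = "'a set \<times> 'a set set"

abbreviation verts :: "'a graph \<Rightarrow> 'a set" where "verts \<equiv> fst"
abbreviation edges :: "'a graph \<Rightarrow> 'a set set" where "edges \<equiv> snd"

definition simple_graph :: "'a graph \<Rightarrow> bool" where
  "simple_graph G \<longleftrightarrow> finite (verts G) \<and> (\<forall>e\<in>edges G. e \<subseteq> verts G \<and> card e = 2)"

definition no_isolated :: "'a graph \<Rightarrow> bool" where
  "no_isolated G \<longleftrightarrow> (\<forall>v\<in>verts G. \<exists>e\<in>edges G. v \<in> e)"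

definition subgraph :: "'a graph \<Rightarrow> 'a graph \<Rightarrow> bool" where
  "subgraph F G \<longleftrightarrow> simple_graph F \<and> verts F \<subseteq> verts G \<and> edges F \<subseteq> edges G"

definition graph_iso :: "'a graph \<Rightarrow> 'b graph \<Rightarrow> bool" where
  "graph_iso F G \<longleftrightarrow>
     (\<exists>f. bij_betw f (verts F) (verts G) \<and> edges G = (\<lambda>e. f ` e) ` edges F)"

definition path_graph :: "nat \<Rightarrow> nat graph" where
  "path_graph n = ({..<n}, {{i, Suc i} | i. Suc i < n})"

definition complete_bipartite :: "nat \<Rightarrow> nat \<Rightarrow> (nat + nat) graph" where
  "complete_bipartite m n =
     (Inl ` {..<m} \<union> Inr ` {..<n}, {{Inl i, Inr j} | i j. i < m \<and> j < n})"

abbreviation star :: "nat \<Rightarrow> (nat + nat) graph" where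
  "star n \<equiv> complete_bipartite 1 n"

definition exact_coloring :: "nat \<Rightarrow> 'a graph \<Rightarrow> ('a set \<Rightarrow> nat) \<Rightarrow> bool" where
  "exact_coloring k G c \<longleftrightarrow> c ` edges G = {1..k}"

definition rainbow :: "('a set \<Rightarrow> nat) \<Rightarrow> 'a graph \<Rightarrow> bool" where
  "rainbow c F \<longleftrightarrow> inj_on c (edges F)"

definition monochromatic :: "('a set \<Rightarrow> nat) \<Rightarrow> 'a graph \<Rightarrow> bool" where
  "monochromatic c F \<longleftrightarrow> (\<forall>e\<in>edges F. \<forall>e'\<in>edges F. c e = c e')"

text \<open>
  \<open>N\<close> counts as a bound only if \<open>K\<^sub>n\<^sub>,\<^sub>n\<close> admits an exact \<open>k\<close>-edge-coloring for every \<open>n \<ge> N\<close>.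
  Otherwise every \<open>n\<close> with \<open>n\<^sup>2 < k\<close> would satisfy the requirement on colorings vacuously
  and the minimum would not see the trivial lower bound \<open>\<lceil>sqrt k\<rceil>\<close>.
\<close>

definition bgr_bound :: "nat \<Rightarrow> 'a graph \<Rightarrow> 'b graph \<Rightarrow> nat \<Rightarrow> bool" where
  "bgr_bound k G H N \<longleftrightarrow>
     (\<forall>n\<ge>N.
        (\<exists>c. exact_coloring k (complete_bipartite n n) c) \<and>
        (\<forall>c. exact_coloring k (complete_bipartite n n) c \<longrightarrow>
           (\<exists>F. subgraph F (complete_bipartite n n) \<and> graph_iso F G \<and> rainbow c F) \<or>
           (\<exists>F. subgraph F (complete_bipartite n n) \<and> graph_iso F H \<and> monochromatic c F)))"

text \<open>
  The value lies in \<^typ>\<open>enat\<close>, so that it is \<open>\<infinity>\<close> if there is no bound; the infimum of a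
  nonempty set of extended naturals is its minimum.
\<close>

definition bgr :: "nat \<Rightarrow> 'a graph \<Rightarrow> 'b graph \<Rightarrow> enat" where
  "bgr k G H = Inf {enat N | N. bgr_bound k G H N}"

end

theory Submission
  imports Defs
begin

text \<open>
  View a coloring of \<open>K\<^sub>n\<^sub>,\<^sub>n\<close> as an \<open>n \<times> n\<close> array. A monochromatic star with \<open>k div 2\<close> edges is
  found as soon as \<open>K\<^sub>n\<^sub>,\<^sub>n\<close> has at least \<open>k\<close> edges, so only the existence of an exact coloring
  matters and both numbers equal \<open>\<lceil>sqrt k\<rceil>\<close>.

  If every row and column has at most two colors, then the color sets of rows and columns
  intersect pairwise, and with at least five colors in total all rows share a color. Hence
  \<open>n \<ge> k - 1\<close>, and the more frequent color of any row occurs at least \<open>k div 2\<close> times.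
  If some row, say, has three colors and there is no rainbow \<open>P\<^sub>5\<close>, then another row with a new
  color has only one new color, and is even constant for \<open>n \<ge> 4\<close>; it then is a star that is large
  enough because there are at most \<open>2n - 1\<close> colors. If no row has a new color, the first row has
  all \<open>k\<close> colors, and any other row either equals it or has at most two colors.
\<close>

section \<open>Counting in finite sets\<close>

lemma obtain_two:
  assumes "2 \<le> card A"
  obtains x y where "x \<in> A" "y \<in> A" "x \<noteq> y"
proof -
  obtain B where "B \<subseteq> A" "card B = 2"
    using obtain_subset_with_card_n[OF assms] by blast
  then show ?thesis
    using that by (auto simp: card_2_iff)
qed

lemma obtain_three:
  assumes "3 \<le> card A"
  obtains x y z where "x \<in> A" "y \<in> A" "z \<in> A" "x \<noteq> y" "x \<noteq> z" "y \<noteq> z"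
proof -
  obtain B where "B \<subseteq> A" "card B = 3"
    using obtain_subset_with_card_n[OF assms] by blast
  then show ?thesis
    using that by (auto simp: card_3_iff)
qed

lemma card_le_2_cases:
  assumes "finite A" "card A \<le> 2" "x \<in> A" "y \<in> A" "x \<noteq> y"
  shows "A = {x, y}"
  using card_seteq[of A "{x, y}"] assms by auto

lemma card_Diff_ge: "finite B \<Longrightarrow> card A - card B \<le> card (A - B)"
  by (simp add: diff_card_le_card_Diff)

text \<open>If all color classes had at most \<open>t - 1\<close> elements, the at most two classes
  would cover only \<open>2 * (t - 1)\<close> elements, fewer than \<open>card J\<close>.\<close>

lemma pigeonhole_two_colors:
  fixes g :: "'b \<Rightarrow> 'c"
  assumes "finite J" "card (g ` J) \<le> 2" "2 * t \<le> card J + 1" "J \<noteq> {}"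
  shows "\<exists>x. t \<le> card {j \<in> J. g j = x}"
proof (rule ccontr)
  assume "\<not> ?thesis"
  then have less: "card {j \<in> J. g j = x} < t" for x by (auto simp: not_le)
  then have *: "card {j \<in> J. g j = x} \<le> t - 1" for x using less[of x] by linarith
  \<comment> \<open>Positivity makes the truncated \<open>t - 1\<close> a true predecessor, which
    the final contradiction relies on.\<close>
  have t: "t > 0" using less by (metis gr_zeroI not_less_zero)
  have "(\<Union>x\<in>g ` J. {j \<in> J. g j = x}) = J" by auto
  then have "card J \<le> (\<Sum>x\<in>g ` J. card {j \<in> J. g j = x})"
    using card_UN_le[of "g ` J" "\<lambda>x. {j \<in> J. g j = x}"] assms(1) by simp
  also have "\<dots> \<le> card (g ` J) * (t - 1)"
    using sum_bounded_above[of "g ` J" "\<lambda>x. card {j \<in> J. g j = x}" "t - 1"] * by simp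
  also have "\<dots> \<le> 2 * (t - 1)"
    using assms(2) by simp
  finally show False using assms(3) t by linarith
qed


section \<open>Colorings with at most two colors at every vertex\<close>

text \<open>Fix a row \<open>u\<close> and three colors \<open>p\<close>, \<open>q\<close>,
  \<open>r\<close> missing from it; they exist because 5 - 2 = 3. Each occurs in a column whose only
  other color is the entry of row \<open>u\<close>. As row \<open>u\<close> has at most two colors,
  two of these three columns agree in row \<open>u\<close>, and the color they share there lies in
  every row.\<close>

lemma common_color:
  fixes f :: "'r \<Rightarrow> 'c \<Rightarrow> 'b"
  assumes fin: "finite I" "finite J"
    and rows: "\<And>i. i \<in> I \<Longrightarrow> card (f i ` J) \<le> 2"
    and cols: "\<And>j. j \<in> J \<Longrightarrow> card ((\<lambda>i. f i j) ` I) \<le> 2"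
    and many: "5 \<le> card (\<Union>i\<in>I. f i ` J)"
  shows "\<exists>x. \<forall>i\<in>I. x \<in> f i ` J"
proof -
  obtain u where u: "u \<in> I" using many by fastforce
  have "3 \<le> card ((\<Union>i\<in>I. f i ` J) - f u ` J)"
    using card_Diff_ge[of "f u ` J" "\<Union>i\<in>I. f i ` J"] rows[OF u] many fin by simp
  then obtain p q r where pqr: "p \<in> (\<Union>i\<in>I. f i ` J) - f u ` J"
    "q \<in> (\<Union>i\<in>I. f i ` J) - f u ` J" "r \<in> (\<Union>i\<in>I. f i ` J) - f u ` J"
    "p \<noteq> q" "p \<noteq> r" "q \<noteq> r"
    by (rule obtain_three)
  \<comment> \<open>A column containing a color missing from row \<open>u\<close> also contains its
    own entry in row \<open>u\<close>, which exhausts its two colors.\<close>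
  have col: "\<exists>j\<in>J. f u j \<noteq> c \<and> (\<forall>i\<in>I. f i j \<in> {f u j, c})"
    if "c \<in> (\<Union>i\<in>I. f i ` J) - f u ` J" for c
  proof -
    from that obtain i j where ij: "i \<in> I" "j \<in> J" "c = f i j" by blast
    with that have ne: "f u j \<noteq> c" by blast
    have "(\<lambda>i. f i j) ` I = {f u j, c}"
      by (rule card_le_2_cases) (use cols fin ij u ne in auto)
    then show ?thesis using ij ne by blast
  qed
  obtain jp where jp: "jp \<in> J" "f u jp \<noteq> p" "\<And>i. i \<in> I \<Longrightarrow> f i jp \<in> {f u jp, p}"
    using col[OF pqr(1)] by blast
  obtain jq where jq: "jq \<in> J" "f u jq \<noteq> q" "\<And>i. i \<in> I \<Longrightarrow> f i jq \<in> {f u jq, q}"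
    using col[OF pqr(2)] by blast
  obtain jr where jr: "jr \<in> J" "f u jr \<noteq> r" "\<And>i. i \<in> I \<Longrightarrow> f i jr \<in> {f u jr, r}"
    using col[OF pqr(3)] by blast
  have not3: "\<not> (a \<noteq> b \<and> a \<noteq> c \<and> b \<noteq> c)" if "i \<in> I" "a \<in> f i ` J" "b \<in> f i ` J" "c \<in> f i ` J" for i a b c
    using card_le_2_cases[of "f i ` J" a b] rows[OF that(1)] fin that(2-4)
    by (metis finite_imageI insertE singletonD)
  \<comment> \<open>A row without the shared color must show the missing colors \<open>c1\<close>
    and \<open>c2\<close> in columns \<open>j1\<close> and \<open>j2\<close>. In column
    \<open>j3\<close> it shows either a color of row \<open>u\<close> or \<open>c3\<close>, a third
    color in both cases.\<close>
  have two_agree: "\<forall>i\<in>I. f u j1 \<in> f i ` J"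
    if "f u j1 = f u j2" "j1 \<in> J" "j2 \<in> J" "j3 \<in> J" "c1 \<noteq> c2" "c1 \<noteq> c3" "c2 \<noteq> c3"
      "c1 \<notin> f u ` J" "c2 \<notin> f u ` J"
      "\<And>i. i \<in> I \<Longrightarrow> f i j1 \<in> {f u j1, c1}" "\<And>i. i \<in> I \<Longrightarrow> f i j2 \<in> {f u j2, c2}"
      "\<And>i. i \<in> I \<Longrightarrow> f i j3 \<in> {f u j3, c3}" for j1 j2 j3 c1 c2 c3
  proof (rule ballI, rule ccontr)
    fix i assume i: "i \<in> I" "f u j1 \<notin> f i ` J"
    have "f i j1 = c1" "f i j2 = c2"
      using that(1-3,10,11) i by (metis imageI insert_iff singletonD)+
    moreover have "f i j3 \<noteq> c1" "f i j3 \<noteq> c2"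
      using that(4,6-9) that(12)[OF i(1)] by auto
    ultimately show False
      using not3[OF i(1), of c1 c2 "f i j3"] that(2-5) by (metis imageI)
  qed
  have "f u jp = f u jq \<or> f u jp = f u jr \<or> f u jq = f u jr"
    using not3[OF u, of "f u jp" "f u jq" "f u jr"] jp jq jr by blast
  then show ?thesis
  proof (elim disjE)
    assume "f u jp = f u jq"
    from two_agree[OF this jp(1) jq(1) jr(1), of p q r] show ?thesis
      using pqr jp jq jr by blast
  next
    assume "f u jp = f u jr"
    from two_agree[OF this jp(1) jr(1) jq(1), of p r q] show ?thesis
      using pqr jp jq jr by blast
  next
    assume "f u jq = f u jr"
    from two_agree[OF this jq(1) jr(1) jp(1), of q r p] show ?thesis
      using pqr jp jq jr by blast
  qed
qed

text \<open>A row that contains a color other than the common one is determined by it, so distinct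
  colors need distinct rows.\<close>

lemma colors_le_rows:
  fixes f :: "'r \<Rightarrow> 'c \<Rightarrow> 'b"
  assumes fin: "finite I" "finite J"
    and rows: "\<And>i. i \<in> I \<Longrightarrow> card (f i ` J) \<le> 2"
    and cols: "\<And>j. j \<in> J \<Longrightarrow> card ((\<lambda>i. f i j) ` I) \<le> 2"
    and many: "5 \<le> card (\<Union>i\<in>I. f i ` J)"
  shows "card (\<Union>i\<in>I. f i ` J) \<le> card I + 1"
proof -
  let ?C = "\<Union>i\<in>I. f i ` J"
  obtain x where x: "\<And>i. i \<in> I \<Longrightarrow> x \<in> f i ` J"
    using common_color[of I J f] assms by metis
  have "\<forall>c\<in>?C - {x}. \<exists>i. i \<in> I \<and> c \<in> f i ` J" by blast
  then obtain g where g: "\<And>c. c \<in> ?C - {x} \<Longrightarrow> g c \<in> I \<and> c \<in> f (g c) ` J" by metis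
  have g_row: "f (g c) ` J = {x, c}" if "c \<in> ?C - {x}" for c
    by (rule card_le_2_cases) (use g[OF that] x[of "g c"] rows fin that in auto)
  have "inj_on g (?C - {x})"
  proof (rule inj_onI)
    fix c d assume cd: "c \<in> ?C - {x}" "d \<in> ?C - {x}" "g c = g d"
    then have "{x, c} = {x, d}" using g_row by metis
    then show "c = d" using cd by (auto simp: doubleton_eq_iff)
  qed
  moreover have "g ` (?C - {x}) \<subseteq> I" using g by blast
  ultimately have "card (?C - {x}) \<le> card I"
    using card_inj_on_le fin by blast
  then show ?thesis
    using card_Diff_ge[of "{x}" ?C] by simp
qed


section \<open>Two rows without a rainbow path on five vertices\<close>

text \<open>If \<open>s\<close> and \<open>a\<close> are the rows of \<open>u\<close> and \<open>u'\<close>, the colors in \<open>no_path\<close> are those of the path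
  \<open>i, u, j, u', l\<close>.\<close>

locale two_rows =
  fixes J :: "'c set" and s a :: "'c \<Rightarrow> 'b"
  assumes no_path: "\<lbrakk>i \<in> J; j \<in> J; l \<in> J; i \<noteq> j; i \<noteq> l; j \<noteq> l\<rbrakk>
    \<Longrightarrow> \<not> distinct [s i, s j, a j, a l]"
begin

context
  fixes v q r
  assumes v: "v \<in> J" and q: "q \<in> J" and r: "r \<in> J"
    and svqr: "distinct [s v, s q, s r]" and new: "a v \<notin> s ` J"
begin

text \<open>Row \<open>a\<close> has a new color in column \<open>v\<close>. The path that starts in
  column \<open>q\<close> and changes rows in column \<open>v\<close> has three distinct colors
  \<open>s v\<close>, \<open>s q\<close>, \<open>a v\<close>, so its last color \<open>a l\<close>
  repeats one of them. For \<open>l = q\<close> the path starts in column \<open>r\<close>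
  instead.\<close>

lemma a_old_or_new: "l \<in> J \<Longrightarrow> a l \<in> insert (a v) (s ` J)"
proof -
  assume l: "l \<in> J"
  have ne: "v \<noteq> q" "v \<noteq> r" "q \<noteq> r" using svqr by auto
  have "a v \<noteq> s v" "a v \<noteq> s q" "a v \<noteq> s r" using new v q r by auto
  then have "a l \<in> {a v, s v, s q, s r}"
    using no_path[of q v l] no_path[of r v q] v q r svqr ne l
    by (cases "l = q"; cases "l = v") auto
  then show ?thesis using v q r by auto
qed

text \<open>Changing rows in column \<open>v\<close> or \<open>q\<close> leaves only
  \<open>s r\<close> and \<open>a v\<close> for \<open>a q\<close>; symmetrically,
  \<open>a r\<close> is \<open>s q\<close> or \<open>a v\<close>. If one of the two takes the old
  color, the paths from \<open>v\<close> that change rows in that column force the other to take its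
  old color too. So either both equal \<open>a v\<close>, or row \<open>a\<close> swaps the two
  colors of \<open>s\<close>.\<close>

lemma a_q_cases: "a q = a v \<or> a q = s r \<and> a r = s q"
  and a_r_cases: "a r = a v \<or> a q = s r \<and> a r = s q"
proof -
  have ne: "v \<noteq> q" "v \<noteq> r" "q \<noteq> r" "s v \<noteq> s q" "s v \<noteq> s r" "s q \<noteq> s r"
    "a v \<noteq> s v" "a v \<noteq> s q" "a v \<noteq> s r"
    using svqr new v q r by auto
  have 1: "a r = s q \<or> a r = s v \<or> a r = a v" using no_path[of q v r] v q r ne by auto
  have 2: "a q = s r \<or> a q = s v \<or> a q = a v" using no_path[of r v q] v q r ne by auto
  have 3: "a q = s r \<or> a q = s q \<or> a q = a v" using no_path[of r q v] v q r ne by auto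
  have 4: "a r = s r \<or> a r = s q \<or> a r = a v" using no_path[of q r v] v q r ne by auto
  have 5: "a r = s v \<or> a r = s q \<or> a r = s r" if "a q = s r"
    using no_path[of v q r] v q r ne that by auto
  have 6: "a q = s v \<or> a q = s q \<or> a q = s r" if "a r = s q"
    using no_path[of v r q] v q r ne that by auto
  show "a q = a v \<or> a q = s r \<and> a r = s q" using 1 2 3 4 5 6 ne by metis
  show "a r = a v \<or> a q = s r \<and> a r = s q" using 1 2 3 4 5 6 ne by metis
qed

text \<open>A fourth column \<open>w\<close> rules out the swap: it would force
  \<open>a w = s v\<close> and \<open>s w\<close> to be \<open>s q\<close> or \<open>s r\<close>,
  and then changing rows in column \<open>v\<close> gives a rainbow path starting in column
  \<open>w\<close>. So \<open>a q = a r = a v\<close>, and changing rows in \<open>q\<close>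
  transfers this to the remaining columns.\<close>

lemma a_const:
  assumes w: "w \<in> J" "w \<notin> {v, q, r}" and l: "l \<in> J"
  shows "a l = a v"
proof -
  have ne: "v \<noteq> q" "v \<noteq> r" "q \<noteq> r" "s v \<noteq> s q" "s v \<noteq> s r" "s q \<noteq> s r"
    "a v \<noteq> s v" "a v \<noteq> s q" "a v \<noteq> s r"
    using svqr new v q r by auto
  have third: "a x = s v \<or> a x = a v" if "x \<in> J" "x \<notin> {v, q, r}" for x
    using no_path[of q v x] no_path[of r v x] v q r ne that by auto
  have "\<not> (a q = s r \<and> a r = s q)"
  proof
    assume sw: "a q = s r \<and> a r = s q"
    have "a w \<noteq> a v" using no_path[of v q w] v q r ne w sw by auto
    then have "a w = s v" using third w by blast
    have "s w \<noteq> a v" using new w by (metis imageI)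
    then have "s w = s q \<or> s w = s r" using no_path[of w q v] v q r ne w sw by auto
    then show False
      using no_path[of w v q] no_path[of w v r] v q r ne w sw by auto
  qed
  then have qr: "a q = a v" "a r = a v" using a_q_cases a_r_cases by auto
  show ?thesis
  proof (cases "l \<in> {v, q, r}")
    case False
    then show ?thesis using third[of l] no_path[of r q l] v q r ne l qr by auto
  qed (use qr in auto)
qed

end

lemma new_color_reps:
  assumes "3 \<le> card (s ` J)"
  obtains q r where "q \<in> J" "r \<in> J" "distinct [s v, s q, s r]"
proof -
  have "2 \<le> card (s ` J - {s v})" using card_Diff_ge[of "{s v}" "s ` J"] assms by simp
  then obtain x y where "x \<in> s ` J - {s v}" "y \<in> s ` J - {s v}" "x \<noteq> y" by (rule obtain_two)
  then show ?thesis using that by auto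
qed

lemma card_new_colors_le_1:
  assumes "3 \<le> card (s ` J)"
  shows "card (a ` J - s ` J) \<le> 1"
proof (cases "a ` J - s ` J = {}")
  case False
  then obtain v where v: "v \<in> J" "a v \<notin> s ` J" by auto
  obtain q r where "q \<in> J" "r \<in> J" "distinct [s v, s q, s r]"
    using new_color_reps[OF assms] by metis
  then have "a ` J - s ` J \<subseteq> {a v}" using a_old_or_new v by blast
  then show ?thesis using card_mono[of "{a v}"] by fastforce
next
  case True
  then show ?thesis by (simp only: card.empty)
qed

lemma new_color_row_const:
  assumes "3 \<le> card (s ` J)" "4 \<le> card J" "v \<in> J" "a v \<notin> s ` J" "l \<in> J"
  shows "a l = a v"
proof -
  obtain q r where qr: "q \<in> J" "r \<in> J" "distinct [s v, s q, s r]"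
    using new_color_reps[OF assms(1)] by metis
  have "card {v, q, r} \<le> 3" by (simp add: card_insert_if)
  then have "0 < card (J - {v, q, r})"
    using card_Diff_ge[of "{v, q, r}" J] assms(2) by simp
  then obtain w where "w \<in> J" "w \<notin> {v, q, r}" by (metis DiffE card_gt_0_iff ex_in_conv)
  then show ?thesis using a_const qr assms by blast
qed

text \<open>Changing rows in column \<open>j\<close>, two starting columns with different further
  colors of \<open>s\<close> are available. The last color \<open>a l\<close> must repeat a color on
  both paths, hence one of the common colors \<open>s j\<close> and \<open>a j\<close>.\<close>

lemma differing_row_two_colors:
  assumes "5 \<le> card (s ` J)" "j \<in> J" "a j \<noteq> s j"
  shows "a ` J \<subseteq> {s j, a j}"
proof
  fix y assume "y \<in> a ` J"
  then obtain l where l: "l \<in> J" "y = a l" by auto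
  \<comment> \<open>Excluding \<open>s l\<close> keeps the starting columns different from
    \<open>l\<close>; five colors leave two after this removal.\<close>
  have "card {s j, a j, s l} \<le> 3" by (simp add: card_insert_if)
  then have "2 \<le> card (s ` J - {s j, a j, s l})"
    using card_Diff_ge[of "{s j, a j, s l}" "s ` J"] assms(1) by simp
  then obtain c d where "c \<in> s ` J - {s j, a j, s l}" "d \<in> s ` J - {s j, a j, s l}" "c \<noteq> d"
    by (rule obtain_two)
  then obtain i1 i2 where i: "i1 \<in> J" "i2 \<in> J" "s i1 \<notin> {s j, a j, s l}" "s i2 \<notin> {s j, a j, s l}"
    "s i1 \<noteq> s i2" by auto
  then have "i1 \<noteq> j" "i1 \<noteq> l" "i2 \<noteq> j" "i2 \<noteq> l" by auto
  then have "a l = s j \<or> a l = a j" if "l \<noteq> j"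
    using i no_path[of i1 j l] no_path[of i2 j l] assms(2,3) l(1) that by auto
  then show "y \<in> {s j, a j}"
    unfolding l(2) by blast
qed

end


section \<open>Monochromatic stars in colorings of the square grid\<close>

text \<open>Only stars centered at a row are recorded; those centered at a column are obtained by
  transposing \<open>f\<close>.\<close>

definition mono_star :: "nat \<Rightarrow> nat \<Rightarrow> (nat \<Rightarrow> nat \<Rightarrow> nat) \<Rightarrow> bool" where
  "mono_star t n f \<longleftrightarrow> (\<exists>i<n. \<exists>x. t \<le> card {j \<in> {..<n}. f i j = x})"

lemma mono_starI: "i < n \<Longrightarrow> t \<le> card {j \<in> {..<n}. f i j = x} \<Longrightarrow> mono_star t n f"
  by (auto simp: mono_star_def)

lemma mono_star_pigeonhole:
  assumes "i < n" "card (f i ` {..<n}) \<le> 2" "2 * t \<le> n + 1"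
  shows "mono_star t n f"
proof -
  have "\<exists>x. t \<le> card {j \<in> {..<n}. f i j = x}"
    by (rule pigeonhole_two_colors) (use assms in auto)
  then show ?thesis using assms(1) mono_starI by metis
qed

text \<open>Counting colors gives \<open>k \<le> n + 1\<close>, so
  \<open>2 * (k div 2) \<le> n + 1\<close> and the pigeonhole principle applies to any row, here row
  0.\<close>

lemma mono_star_if_no_rainbow_claw:
  fixes f :: "nat \<Rightarrow> nat \<Rightarrow> nat"
  assumes "\<And>i. i < n \<Longrightarrow> card (f i ` {..<n}) \<le> 2"
    and "\<And>j. j < n \<Longrightarrow> card ((\<lambda>i. f i j) ` {..<n}) \<le> 2"
    and "(\<Union>i<n. f i ` {..<n}) = {1..k}" "5 \<le> k"
  shows "mono_star (k div 2) n f"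
proof -
  have "k \<le> n + 1" using colors_le_rows[of "{..<n}" "{..<n}" f] assms by simp
  then show ?thesis using mono_star_pigeonhole[of 0 n f] assms by simp
qed

text \<open>This covers the paths whose ends and middle vertex are columns; the transposed array
  covers the others.\<close>

definition no_rainbow_path :: "nat \<Rightarrow> (nat \<Rightarrow> nat \<Rightarrow> nat) \<Rightarrow> bool" where
  "no_rainbow_path n f \<longleftrightarrow> (\<forall>u u' i j l. u < n \<and> u' < n \<and> u \<noteq> u' \<and> i < n \<and> j < n \<and> l < n \<and>
     i \<noteq> j \<and> i \<noteq> l \<and> j \<noteq> l \<longrightarrow> \<not> distinct [f u i, f u j, f u' j, f u' l])"

lemma no_rainbow_path_two_rows:
  "no_rainbow_path n f \<Longrightarrow> u < n \<Longrightarrow> u' < n \<Longrightarrow> u \<noteq> u' \<Longrightarrow> two_rows {..<n} (f u) (f u')"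
  by (rule two_rows.intro) (simp add: no_rainbow_path_def del: distinct.simps)

text \<open>Each of the other \<open>n - 1\<close> rows adds at most one color to those of row
  \<open>u\<close>.\<close>

lemma colors_le_row_plus:
  fixes f :: "nat \<Rightarrow> nat \<Rightarrow> nat"
  assumes np: "no_rainbow_path n f" and u: "u < n" "3 \<le> card (f u ` {..<n})"
  shows "card (\<Union>i<n. f i ` {..<n}) \<le> card (f u ` {..<n}) + (n - 1)"
proof -
  let ?D = "f u ` {..<n}"
  have "(\<Union>i<n. f i ` {..<n}) = ?D \<union> (\<Union>i\<in>{..<n} - {u}. f i ` {..<n} - ?D)"
    using u by auto
  then have "card (\<Union>i<n. f i ` {..<n}) \<le> card ?D + card (\<Union>i\<in>{..<n} - {u}. f i ` {..<n} - ?D)"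
    by (metis card_Un_le)
  also have "card (\<Union>i\<in>{..<n} - {u}. f i ` {..<n} - ?D) \<le> (\<Sum>i\<in>{..<n} - {u}. card (f i ` {..<n} - ?D))"
    by (rule card_UN_le) simp
  also have "\<dots> \<le> (\<Sum>i\<in>{..<n} - {u}. 1)"
    using two_rows.card_new_colors_le_1[OF no_rainbow_path_two_rows[OF np u(1)]] u
    by (intro sum_mono) auto
  also have "\<dots> = n - 1" using u by simp
  finally show ?thesis by simp
qed

text \<open>In an injective row \<open>a\<close> the alternative \<open>a q = a v\<close> of
  \<open>a_q_cases\<close> is impossible, which leaves the swap.\<close>

lemma swap_in_proper_rows:
  fixes s a :: "nat \<Rightarrow> nat"
  assumes "two_rows {..<3} s a" "inj_on s {..<3}" "inj_on a {..<3}" "v < 3" "a v \<notin> s ` {..<3}"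
    "q < 3" "r < 3" "distinct [v, q, r]"
  shows "a q = s r"
proof -
  have "distinct [s v, s q, s r]" using assms by (auto simp: inj_on_eq_iff)
  then show ?thesis
    using two_rows.a_q_cases[OF assms(1), of v q r] assms by (auto simp: inj_on_eq_iff)
qed

text \<open>The case of three columns is separate because there is no fourth column to make a row
  constant. Without a monochromatic pair all rows and columns are injective. Row 0 has three colors,
  so rows 1 and 2 each contribute exactly one new color, in columns \<open>v\<close> and
  \<open>w\<close>, and elsewhere swap entries of row 0.\<close>

lemma mono_star_3:
  fixes f :: "nat \<Rightarrow> nat \<Rightarrow> nat"
  assumes np: "no_rainbow_path 3 f"
    and col: "5 \<le> card (\<Union>i<3. f i ` {..<3})"
  shows "mono_star 2 3 f \<or> mono_star 2 3 (\<lambda>j i. f i j)"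
proof (rule ccontr)
  assume neg: "\<not> ?thesis"
  have inj: "inj_on (g i) {..<3}" if "\<not> mono_star 2 3 g" "i < 3" for g :: "nat \<Rightarrow> nat \<Rightarrow> nat" and i
  proof (rule inj_onI, rule ccontr)
    fix x y assume xy: "x \<in> {..<3::nat}" "y \<in> {..<3}" "g i x = g i y" "x \<noteq> y"
    have "card {x, y} \<le> card {j \<in> {..<3}. g i j = g i x}"
      by (rule card_mono) (use xy in auto)
    then show False using mono_starI[of i 3 2 g "g i x"] that xy by simp
  qed
  have rows: "inj_on (f i) {..<3}" if "i < 3" for i using inj[of f i] neg that by blast
  have cols: "inj_on (\<lambda>i. f i j) {..<3}" if "j < 3" for j
    using inj[of "\<lambda>j i. f i j" j] neg that by blast
  let ?D = "f 0 ` {..<3}"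
  have D: "card ?D = 3" using card_image[OF rows[of 0]] by simp
  have U: "(\<Union>i<3. f i ` {..<3}) = ?D \<union> (f 1 ` {..<3} - ?D) \<union> (f 2 ` {..<3} - ?D)"
    by (auto simp: less_Suc_eq numeral_3_eq_3 numeral_2_eq_2)
  have tr: "two_rows {..<3} (f i) (f j)" if "i < 3" "j < 3" "i \<noteq> j" for i j
    using no_rainbow_path_two_rows[OF np] that by auto
  have le: "card (f i ` {..<3} - ?D) \<le> 1" if "i = 1 \<or> i = 2" for i
    using two_rows.card_new_colors_le_1[OF tr[of 0 i]] D that by auto
  have bound: "card (\<Union>i<3. f i ` {..<3}) \<le> 3 + card (f 1 ` {..<3} - ?D) + card (f 2 ` {..<3} - ?D)"
    unfolding U
    using card_Un_le[of "?D \<union> (f 1 ` {..<3} - ?D)" "f 2 ` {..<3} - ?D"]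
      card_Un_le[of ?D "f 1 ` {..<3} - ?D"] D by linarith
  moreover have "card (f 1 ` {..<3} - ?D) \<le> 1" "card (f 2 ` {..<3} - ?D) \<le> 1"
    by (rule le, simp)+
  ultimately have "card (f 1 ` {..<3} - ?D) \<noteq> 0" "card (f 2 ` {..<3} - ?D) \<noteq> 0"
    using col by linarith+
  then have "f 1 ` {..<3} - ?D \<noteq> {}" "f 2 ` {..<3} - ?D \<noteq> {}"
    by (metis card.empty)+
  then obtain v w where v: "v < 3" "f 1 v \<notin> ?D" and w: "w < 3" "f 2 w \<notin> ?D"
    by blast
  have sw1: "f 1 q = f 0 r" if "q < 3" "r < 3" "distinct [v, q, r]" for q r
    by (rule swap_in_proper_rows[OF tr rows rows v that]) simp_all
  have sw2: "f 2 q = f 0 r" if "q < 3" "r < 3" "distinct [w, q, r]" for q r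
    by (rule swap_in_proper_rows[OF tr rows rows w that]) simp_all
  show False
  proof (cases "v = w")
    case True
    obtain q r where qr: "q < 3" "r < 3" "distinct [v, q, r]"
    proof -
      have "v = 0 \<or> v = 1 \<or> v = 2" using v(1) by linarith
      then show ?thesis using that[of 1 2] that[of 0 2] that[of 0 1] by auto
    qed
    \<comment> \<open>With the new colors in the same column, rows 1 and 2 make the same swap, so
      column \<open>q\<close> repeats a color.\<close>
    then have "f 1 q = f 2 q" using sw1 sw2 True by simp
    then show False using cols[OF qr(1)] by (auto dest: inj_onD[of _ _ 1 2])
  next
    case False
    obtain z where z: "z < 3" "distinct [v, w, z]"
    proof -
      have "v = 0 \<or> v = 1 \<or> v = 2" "w = 0 \<or> w = 1 \<or> w = 2" using v(1) w(1) by linarith+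
      then show ?thesis using that[of 0] that[of 1] that[of 2] False by fastforce
    qed
    have "f 1 w = f 0 z" "f 2 z = f 0 v" using sw1[of w z] sw2[of z v] z v w by auto
    \<comment> \<open>If the two new colors coincided, there would be only four colors in
      total.\<close>
    moreover have "f 2 w \<noteq> f 1 v"
    proof
      assume "f 2 w = f 1 v"
      then have "(\<Union>i<3. f i ` {..<3}) \<subseteq> insert (f 1 v) ?D"
        unfolding U
        using two_rows.a_old_or_new[OF tr[of 0 1], of v w z] two_rows.a_old_or_new[OF tr[of 0 2], of w v z]
          v w z rows[of 0] by (auto simp: inj_on_eq_iff)
      then have "card (\<Union>i<3. f i ` {..<3}) \<le> card (insert (f 1 v) ?D)"
        by (intro card_mono) auto
      then show False using D col by (simp add: card_insert_if split: if_splits)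
    qed
    moreover have "f 0 z \<noteq> f 0 v" using rows[of 0] z v by (auto simp: inj_on_eq_iff)
    moreover have "f 1 v \<noteq> f 0 z" "f 1 v \<noteq> f 0 v" "f 2 w \<noteq> f 0 z" "f 2 w \<noteq> f 0 v"
      using v w z by auto
    \<comment> \<open>The two new colors alternate with two different colors of row 0 along a path
      through rows 1 and 2 that changes rows in column \<open>w\<close>.\<close>
    ultimately have "distinct [f 1 v, f 1 w, f 2 w, f 2 z]" by auto
    then show False using two_rows.no_path[OF tr[of 1 2], of v w z] v w z by auto
  qed
qed

lemma mono_star_if_rainbow_claw:
  fixes f :: "nat \<Rightarrow> nat \<Rightarrow> nat"
  assumes np: "no_rainbow_path n f" and u: "u < n" and three: "3 \<le> card (f u ` {..<n})"
    and colors: "(\<Union>i<n. f i ` {..<n}) = {1..k}" "5 \<le> k"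
  shows "mono_star (k div 2) n f \<or> mono_star (k div 2) n (\<lambda>j i. f i j)"
proof -
  have dn: "card (f u ` {..<n}) \<le> n" using card_image_le[of "{..<n}" "f u"] by simp
  have kd: "k \<le> card (f u ` {..<n}) + (n - 1)"
    using colors_le_row_plus[OF np u three] colors(1) by simp
  consider "n = 3" | "n \<ge> 4" using dn three by linarith
  then show ?thesis
  proof cases
    case 1
    \<comment> \<open>Here \<open>5 \<le> k \<le> 3 + 2\<close>.\<close>
    then have "k div 2 = 2" using kd dn colors(2) by auto
    then show ?thesis using mono_star_3[of f] np colors 1 by simp
  next
    case n: 2
    show ?thesis
    proof (cases "\<exists>i<n. \<exists>j<n. f i j \<notin> f u ` {..<n}")
      case True
      then obtain i j where ij: "i < n" "j < n" "f i j \<notin> f u ` {..<n}" by blast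
      have "u \<noteq> i"
      proof
        assume "u = i"
        then show False using ij(2,3) by simp
      qed
      then have rows: "two_rows {..<n} (f u) (f i)"
        by (rule no_rainbow_path_two_rows[OF np u ij(1)])
      have "f i l = f i j" if "l < n" for l
        by (rule two_rows.new_color_row_const[OF rows three _ _ ij(3)]) (use n ij(2) that in simp_all)
      then have "{l \<in> {..<n}. f i l = f i j} = {..<n}" by auto
      \<comment> \<open>Row \<open>i\<close> is constant, and \<open>k \<le> 2 * n - 1\<close> makes
        its \<open>n\<close> edges enough.\<close>
      then have "mono_star (k div 2) n f"
        using ij(1) kd dn by (intro mono_starI[of i n _ f "f i j"]) simp_all
      then show ?thesis ..
    next
      case False
      have "{1..k} \<subseteq> f u ` {..<n}"
        unfolding colors(1)[symmetric]
      proof (intro UN_least image_subsetI)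
        fix i j assume "i \<in> {..<n}" "j \<in> {..<n}"
        then show "f i j \<in> f u ` {..<n}" using False by blast
      qed
      then have "card {1..k} \<le> card (f u ` {..<n})" by (rule card_mono[rotated]) simp
      then have d: "k \<le> card (f u ` {..<n})" by simp
      show ?thesis
      proof (cases "\<exists>i<n. \<exists>j<n. f i j \<noteq> f u j")
        case True
        then obtain i j where ij: "i < n" "j < n" "f i j \<noteq> f u j" by blast
        then have "u \<noteq> i" by metis
        then have rows: "two_rows {..<n} (f u) (f i)"
          by (rule no_rainbow_path_two_rows[OF np u ij(1)])
        have "f i ` {..<n} \<subseteq> {f u j, f i j}"
          by (rule two_rows.differing_row_two_colors[OF rows]) (use d colors(2) ij in simp_all)
        then have "card (f i ` {..<n}) \<le> card {f u j, f i j}" by (rule card_mono[rotated]) simp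
        then have "card (f i ` {..<n}) \<le> 2" using ij(3) by simp
        \<comment> \<open>Row \<open>u\<close> shows all \<open>k\<close> colors, so
          \<open>2 * (k div 2) \<le> k \<le> n\<close>.\<close>
        then have "mono_star (k div 2) n f"
          by (rule mono_star_pigeonhole[OF ij(1)]) (use dn d in simp)
        then show ?thesis ..
      next
        case False
        \<comment> \<open>All rows coincide, so every column is constant; \<open>u\<close> serves as
          a column index known to be below \<open>n\<close>.\<close>
        then have "{i \<in> {..<n}. f i u = f u u} = {..<n}" using u by blast
        then have "mono_star (k div 2) n (\<lambda>j i. f i j)"
          using u dn d by (intro mono_starI[of u n _ _ "f u u"]) simp_all
        then show ?thesis ..
      qed
    qed
  qed
qed


section \<open>Embedding into the complete bipartite graph\<close>

lemma graph_iso_trans: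
  assumes "graph_iso F G" "graph_iso G H"
  shows "graph_iso F H"
proof -
  obtain f where f: "bij_betw f (verts F) (verts G)" "edges G = (\<lambda>e. f ` e) ` edges F"
    using assms(1) unfolding graph_iso_def by (elim exE conjE)
  obtain g where g: "bij_betw g (verts G) (verts H)" "edges H = (\<lambda>e. g ` e) ` edges G"
    using assms(2) unfolding graph_iso_def by (elim exE conjE)
  have "bij_betw (g \<circ> f) (verts F) (verts H)" by (rule bij_betw_trans[OF f(1) g(1)])
  moreover have "edges H = (\<lambda>e. (g \<circ> f) ` e) ` edges F"
    unfolding g(2) f(2) by (simp only: image_image image_comp comp_def)
  ultimately show ?thesis unfolding graph_iso_def by (intro exI conjI)
qed

definition image_graph :: "('a \<Rightarrow> 'b) \<Rightarrow> 'a graph \<Rightarrow> 'b graph" where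
  "image_graph g G = (g ` verts G, (\<lambda>e. g ` e) ` edges G)"

lemma graph_iso_image_graph:
  assumes "simple_graph G" "inj_on g (verts G)"
  shows "graph_iso (image_graph g G) G"
proof -
  \<comment> \<open>\<open>graph_iso\<close> maps the copy onto the pattern, hence the inverse of
    the embedding.\<close>
  let ?h = "inv_into (verts G) g"
  have "bij_betw ?h (g ` verts G) (verts G)"
    using assms(2) by (simp add: bij_betw_inv_into inj_on_imp_bij_betw)
  moreover have cancel: "?h ` g ` e = e" if "e \<in> edges G" for e
    using assms(1) that by (intro inv_into_image_cancel[OF assms(2)]) (simp add: simple_graph_def)
  have "edges G = (\<lambda>e. ?h ` e) ` (\<lambda>e. g ` e) ` edges G"
  proof -
    have "(\<lambda>e. ?h ` e) ` (\<lambda>e. g ` e) ` edges G = (\<lambda>e. ?h ` g ` e) ` edges G" by (rule image_image)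
    also have "\<dots> = (\<lambda>e. e) ` edges G" by (rule image_cong[OF refl cancel])
    finally show ?thesis by simp
  qed
  ultimately show ?thesis unfolding graph_iso_def image_graph_def fst_conv snd_conv by blast
qed

lemma subgraph_image_graph:
  assumes "simple_graph G" "simple_graph K" "g ` verts G \<subseteq> verts K"
    "\<And>e. e \<in> edges G \<Longrightarrow> g ` e \<in> edges K"
  shows "subgraph (image_graph g G) K"
proof -
  have edges: "(\<lambda>e. g ` e) ` edges G \<subseteq> edges K" using assms(4) by blast
  have "finite (g ` verts G)" using assms(1) by (simp add: simple_graph_def)
  \<comment> \<open>That \<open>g\<close> does not collapse an edge follows from its image being an
    edge of the simple graph \<open>K\<close>.\<close>
  moreover have "g ` e \<subseteq> g ` verts G \<and> card (g ` e) = 2" if "e \<in> edges G" for e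
    using assms(1,2) assms(4)[OF that] that by (simp add: simple_graph_def image_mono)
  ultimately have "simple_graph (image_graph g G)"
    unfolding simple_graph_def image_graph_def fst_conv snd_conv by blast
  then show ?thesis using edges assms(3) by (simp add: subgraph_def image_graph_def)
qed

section \<open>Complete bipartite graphs and the path on five vertices\<close>

lemma edges_complete_bipartite:
  "edges (complete_bipartite m n) = (\<lambda>(i, j). {Inl i, Inr j}) ` ({..<m} \<times> {..<n})"
  by (auto simp: complete_bipartite_def)

lemma in_verts_complete_bipartite [simp]:
  "Inl i \<in> verts (complete_bipartite m n) \<longleftrightarrow> i < m"
  "Inr j \<in> verts (complete_bipartite m n) \<longleftrightarrow> j < n"
  by (auto simp: complete_bipartite_def)

lemma in_edges_complete_bipartite [simp]:
  assumes "i < m" "j < n"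
  shows "{Inl i, Inr j} \<in> edges (complete_bipartite m n)"
    and "{Inr j, Inl i} \<in> edges (complete_bipartite m n)"
proof -
  show "{Inl i, Inr j} \<in> edges (complete_bipartite m n)"
    unfolding edges_complete_bipartite by (rule image_eqI[of _ _ "(i, j)"]) (use assms in auto)
  then show "{Inr j, Inl i} \<in> edges (complete_bipartite m n)"
    by (simp add: insert_commute)
qed

lemma simple_complete_bipartite: "simple_graph (complete_bipartite m n)"
  by (auto simp: simple_graph_def complete_bipartite_def)

lemma edges_path_5: "edges (path_graph 5) = {{0, 1}, {1, 2}, {2, 3}, {3, 4}}"
proof -
  have "edges (path_graph 5) = (\<lambda>i. {i, Suc i}) ` {..<4}"
    by (auto simp: path_graph_def)
  also have "{..<4} = {0, 1, 2, 3::nat}" by auto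
  finally show ?thesis by (simp add: eval_nat_numeral)
qed

lemma simple_path_5: "simple_graph (path_graph 5)"
  unfolding simple_graph_def edges_path_5 by (simp add: path_graph_def)

text \<open>Together with \<open>contains_mono\<close>, this names the two alternatives in
  \<open>bgr_bound\<close>.\<close>

definition contains_rainbow :: "nat \<Rightarrow> ((nat + nat) set \<Rightarrow> nat) \<Rightarrow> 'a graph \<Rightarrow> bool" where
  "contains_rainbow n c G \<longleftrightarrow>
     (\<exists>F. subgraph F (complete_bipartite n n) \<and> graph_iso F G \<and> rainbow c F)"

definition contains_mono :: "nat \<Rightarrow> ((nat + nat) set \<Rightarrow> nat) \<Rightarrow> 'a graph \<Rightarrow> bool" where
  "contains_mono n c G \<longleftrightarrow>
     (\<exists>F. subgraph F (complete_bipartite n n) \<and> graph_iso F G \<and> monochromatic c F)"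

lemma contains_rainbowI:
  assumes "simple_graph G" "inj_on g (verts G)" "g ` verts G \<subseteq> verts (complete_bipartite n n)"
    "\<And>e. e \<in> edges G \<Longrightarrow> g ` e \<in> edges (complete_bipartite n n)"
    "inj_on (\<lambda>e. c (g ` e)) (edges G)"
  shows "contains_rainbow n c G"
  unfolding contains_rainbow_def
proof (intro exI conjI)
  show "subgraph (image_graph g G) (complete_bipartite n n)"
    using subgraph_image_graph[OF assms(1) simple_complete_bipartite assms(3,4)] .
  show "graph_iso (image_graph g G) G" using graph_iso_image_graph assms by blast
  show "rainbow c (image_graph g G)"
    using assms(5) by (auto simp: rainbow_def image_graph_def inj_on_def)
qed

lemma contains_rainbow_path_5:
  assumes "distinct [c {x0, x1}, c {x1, x2}, c {x2, x3}, c {x3, x4}]"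
    and "distinct [x0, x1, x2, x3, x4]"
    and "set [x0, x1, x2, x3, x4] \<subseteq> verts (complete_bipartite n n)"
    and "set [{x0, x1}, {x1, x2}, {x2, x3}, {x3, x4}] \<subseteq> edges (complete_bipartite n n)"
  shows "contains_rainbow n c (path_graph 5)"
proof (rule contains_rainbowI)
  let ?g = "nth [x0, x1, x2, x3, x4]"
  have V: "verts (path_graph 5) = {0, 1, 2, 3, 4}" by (auto simp: path_graph_def)
  show "inj_on ?g (verts (path_graph 5))" using assms(2) by (simp add: V)
  show "?g ` verts (path_graph 5) \<subseteq> verts (complete_bipartite n n)" using assms(3) by (simp add: V)
  show "?g ` e \<in> edges (complete_bipartite n n)" if "e \<in> edges (path_graph 5)" for e
    using that assms(4) by (auto simp: edges_path_5)
  show "inj_on (\<lambda>e. c (?g ` e)) (edges (path_graph 5))"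
    using assms(1) by (auto simp: edges_path_5)
qed (rule simple_path_5)

section \<open>From patterns in the array to rainbow and monochromatic subgraphs\<close>

definition row_coloring :: "((nat + nat) set \<Rightarrow> nat) \<Rightarrow> nat \<Rightarrow> nat \<Rightarrow> nat" where
  "row_coloring c i j = c {Inl i, Inr j}"

text \<open>The second and fourth vertices of a path on five vertices lie on the same side; the two
  claims treat the two sides.\<close>

lemma no_rainbow_path_row_coloring:
  assumes "\<not> contains_rainbow n c (path_graph 5)"
  shows "no_rainbow_path n (row_coloring c)" "no_rainbow_path n (\<lambda>j i. row_coloring c i j)"
proof -
  show "no_rainbow_path n (row_coloring c)"
    unfolding no_rainbow_path_def row_coloring_def
  proof (intro allI impI notI)
    fix u u' i j l
    assume *: "u < n \<and> u' < n \<and> u \<noteq> u' \<and> i < n \<and> j < n \<and> l < n \<and> i \<noteq> j \<and> i \<noteq> l \<and> j \<noteq> l"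
      "distinct [c {Inl u, Inr i}, c {Inl u, Inr j}, c {Inl u', Inr j}, c {Inl u', Inr l}]"
    have "contains_rainbow n c (path_graph 5)"
      by (rule contains_rainbow_path_5[of _ "Inr i" "Inl u" "Inr j" "Inl u'" "Inr l"])
        (use * in \<open>auto simp: complete_bipartite_def insert_commute\<close>)
    then show False using assms by blast
  qed
  show "no_rainbow_path n (\<lambda>j i. row_coloring c i j)"
    unfolding no_rainbow_path_def row_coloring_def
  proof (intro allI impI notI)
    fix u u' i j l
    assume *: "u < n \<and> u' < n \<and> u \<noteq> u' \<and> i < n \<and> j < n \<and> l < n \<and> i \<noteq> j \<and> i \<noteq> l \<and> j \<noteq> l"
      "distinct [c {Inl i, Inr u}, c {Inl j, Inr u}, c {Inl j, Inr u'}, c {Inl l, Inr u'}]"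
    have "contains_rainbow n c (path_graph 5)"
      by (rule contains_rainbow_path_5[of _ "Inl i" "Inr u" "Inl j" "Inr u'" "Inl l"])
        (use * in \<open>auto simp: complete_bipartite_def insert_commute\<close>)
    then show False using assms by blast
  qed
qed

text \<open>The center goes to \<open>x\<close> and the leaves follow \<open>h\<close>. The free
  target type lets \<open>x\<close> lie on either side of the host graph.\<close>

definition star_map :: "'b \<Rightarrow> (nat \<Rightarrow> 'b) \<Rightarrow> nat + nat \<Rightarrow> 'b" where
  "star_map x h = case_sum (\<lambda>_. x) h"

lemma star_map_simps [simp]: "star_map x h (Inl i) = x" "star_map x h (Inr j) = h j"
  by (simp_all add: star_map_def)

lemma verts_star: "verts (star m) = insert (Inl 0) (Inr ` {..<m})"
  by (auto simp: complete_bipartite_def)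

lemma edges_star: "edges (star m) = (\<lambda>j. {Inl 0, Inr j}) ` {..<m}"
  by (auto simp: complete_bipartite_def)

lemma inj_on_star_map:
  assumes "inj_on h {..<m}" "x \<notin> h ` {..<m}"
  shows "inj_on (star_map x h) (verts (star m))"
proof -
  have "inj_on (star_map x h \<circ> Inr) {..<m}" using assms(1) by (simp add: comp_def)
  then have "inj_on (star_map x h) (Inr ` {..<m})" by (rule inj_on_imageI)
  moreover have "star_map x h ` (Inr ` {..<m} - {Inl 0}) \<subseteq> h ` {..<m}" by auto
  ultimately show ?thesis
    unfolding verts_star inj_on_insert star_map_simps using assms(2) by blast
qed

lemma contains_rainbow_star:
  assumes "inj_on h {..<m}" "x \<notin> h ` {..<m}" "inj_on (\<lambda>j. c {x, h j}) {..<m}"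
    "insert x (h ` {..<m}) \<subseteq> verts (complete_bipartite n n)"
    "\<And>j. j < m \<Longrightarrow> {x, h j} \<in> edges (complete_bipartite n n)"
  shows "contains_rainbow n c (star m)"
proof (rule contains_rainbowI)
  show "inj_on (star_map x h) (verts (star m))" by (rule inj_on_star_map[OF assms(1,2)])
  show "star_map x h ` verts (star m) \<subseteq> verts (complete_bipartite n n)"
    using assms(4) unfolding verts_star by auto
  show "star_map x h ` e \<in> edges (complete_bipartite n n)" if "e \<in> edges (star m)" for e
    using that assms(5) unfolding edges_star by auto
  show "inj_on (\<lambda>e. c (star_map x h ` e)) (edges (star m))"
    unfolding edges_star by (rule inj_on_imageI) (use assms(3) in \<open>simp add: comp_def\<close>)
qed (rule simple_complete_bipartite)

text \<open>Restricting the embedding of the whole star to \<open>F0\<close> gives a monochromatic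
  copy of \<open>F0\<close>, and composing isomorphisms turns it into a copy of
  \<open>H\<close>.\<close>

lemma contains_mono_star:
  assumes F0: "subgraph F0 (star m)" "graph_iso F0 H"
    and "inj_on h {..<m}" "x \<notin> h ` {..<m}" "\<And>j. j < m \<Longrightarrow> c {x, h j} = d"
    and "insert x (h ` {..<m}) \<subseteq> verts (complete_bipartite n n)"
    and "\<And>j. j < m \<Longrightarrow> {x, h j} \<in> edges (complete_bipartite n n)"
  shows "contains_mono n c H"
  unfolding contains_mono_def
proof (intro exI conjI)
  let ?g = "star_map x h"
  have F: "simple_graph F0" "verts F0 \<subseteq> verts (star m)" "edges F0 \<subseteq> edges (star m)"
    using F0 by (auto simp: subgraph_def)
  have edge: "\<exists>j<m. ?g ` e = {x, h j}" if "e \<in> edges F0" for e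
  proof -
    have "e \<in> edges (star m)" using that F(3) by (rule subsetD[rotated])
    then obtain j where "j < m" "e = {Inl 0, Inr j}" unfolding edges_star by (elim imageE) simp
    then show ?thesis by (intro exI[of _ j]) simp
  qed
  have "?g ` verts (star m) \<subseteq> insert x (h ` {..<m})" unfolding verts_star by auto
  then have "?g ` verts F0 \<subseteq> verts (complete_bipartite n n)"
    using image_mono[OF F(2), of ?g] assms(6) by (meson order_trans)
  moreover have "?g ` e \<in> edges (complete_bipartite n n)" if "e \<in> edges F0" for e
  proof -
    obtain j where "j < m" "?g ` e = {x, h j}" using edge[OF \<open>e \<in> edges F0\<close>] by blast
    then show ?thesis by (simp only: assms(7))
  qed
  ultimately show "subgraph (image_graph ?g F0) (complete_bipartite n n)"
    by (intro subgraph_image_graph F simple_complete_bipartite)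
  have "inj_on ?g (verts F0)" by (rule inj_on_subset[OF inj_on_star_map[OF assms(3,4)] F(2)])
  then show "graph_iso (image_graph ?g F0) H"
    by (intro graph_iso_trans[OF _ F0(2)] graph_iso_image_graph F(1))
  have color: "c e = d" if e: "e \<in> edges (image_graph ?g F0)" for e
  proof -
    obtain e0 where e0: "e0 \<in> edges F0" "e = ?g ` e0" using e by (auto simp: image_graph_def)
    obtain j where "j < m" "?g ` e0 = {x, h j}" using edge[OF e0(1)] by blast
    then show ?thesis unfolding e0(2) by (simp only: assms(5))
  qed
  show "monochromatic c (image_graph ?g F0)"
    unfolding monochromatic_def by (intro ballI) (simp only: color)
qed

lemma obtain_enumeration:
  assumes "m \<le> card A"
  obtains h :: "nat \<Rightarrow> 'b" where "inj_on h {..<m}" "h ` {..<m} \<subseteq> A"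
proof -
  obtain B where "B \<subseteq> A" "card B = m" "finite B"
    using obtain_subset_with_card_n[OF assms] by blast
  then show ?thesis
    using that ex_bij_betw_nat_finite[of B] by (auto simp: bij_betw_def atLeast0LessThan)
qed

lemma contains_mono_if_mono_star:
  assumes F0: "subgraph F0 (star m)" "graph_iso F0 H"
    and star: "mono_star m n (row_coloring c) \<or> mono_star m n (\<lambda>j i. row_coloring c i j)"
  shows "contains_mono n c H"
  using star
proof
  assume "mono_star m n (row_coloring c)"
  then obtain i d where i: "i < n" "m \<le> card {j \<in> {..<n}. row_coloring c i j = d}"
    by (auto simp: mono_star_def)
  then obtain h where h: "inj_on h {..<m}" "h ` {..<m} \<subseteq> {j \<in> {..<n}. row_coloring c i j = d}"
    using obtain_enumeration by metis
  then have hn: "h j < n" "c {Inl i, Inr (h j)} = d" if "j < m" for j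
    using that by (auto simp: row_coloring_def image_subset_iff)
  show ?thesis
    by (rule contains_mono_star[OF F0, of "\<lambda>j. Inr (h j)" "Inl i" _ d])
      (use h(1) hn i(1) in \<open>auto simp: inj_on_def\<close>)
next
  assume "mono_star m n (\<lambda>j i. row_coloring c i j)"
  then obtain i d where i: "i < n" "m \<le> card {j \<in> {..<n}. row_coloring c j i = d}"
    by (auto simp: mono_star_def)
  then obtain h where h: "inj_on h {..<m}" "h ` {..<m} \<subseteq> {j \<in> {..<n}. row_coloring c j i = d}"
    using obtain_enumeration by metis
  then have hn: "h j < n" "c {Inl (h j), Inr i} = d" if "j < m" for j
    using that by (auto simp: row_coloring_def image_subset_iff)
  show ?thesis
    by (rule contains_mono_star[OF F0, of "\<lambda>j. Inl (h j)" "Inr i" _ d])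
      (use h(1) hn i(1) in \<open>auto simp: inj_on_def insert_commute\<close>)
qed

text \<open>Choosing one neighbor for each of \<open>m\<close> colors at a vertex gives the leaves;
  \<open>inv_into\<close> makes the choice.\<close>

lemma contains_rainbow_star_if_many_colors:
  assumes "i < n" "m \<le> card (row_coloring c i ` {..<n}) \<or> m \<le> card ((\<lambda>j. row_coloring c j i) ` {..<n})"
  shows "contains_rainbow n c (star m)"
  using assms(2)
proof
  assume "m \<le> card (row_coloring c i ` {..<n})"
  then obtain h where h: "inj_on h {..<m}" "h ` {..<m} \<subseteq> row_coloring c i ` {..<n}"
    using obtain_enumeration by metis
  let ?g = "\<lambda>x. inv_into {..<n} (row_coloring c i) (h x)"
  have g: "?g x < n" "row_coloring c i (?g x) = h x" if "x < m" for x
    using h(2) that inv_into_into[of "h x" "row_coloring c i" "{..<n}"]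
      f_inv_into_f[of "h x" "row_coloring c i" "{..<n}"] by auto
  show ?thesis
  proof (rule contains_rainbow_star[of "\<lambda>j. Inr (?g j)" _ "Inl i"])
    show "inj_on (\<lambda>j. Inr (?g j)) {..<m}"
      using g(2) h(1) unfolding inj_on_def by (metis lessThan_iff sum.inject(2))
    show "inj_on (\<lambda>j. c {Inl i, Inr (?g j)}) {..<m}"
      using g(2) h(1) unfolding inj_on_def row_coloring_def by auto
  qed (use g assms(1) in \<open>auto simp: complete_bipartite_def\<close>)
next
  assume "m \<le> card ((\<lambda>j. row_coloring c j i) ` {..<n})"
  then obtain h where h: "inj_on h {..<m}" "h ` {..<m} \<subseteq> (\<lambda>j. row_coloring c j i) ` {..<n}"
    using obtain_enumeration by metis
  let ?g = "\<lambda>x. inv_into {..<n} (\<lambda>j. row_coloring c j i) (h x)"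
  have g: "?g x < n" "row_coloring c (?g x) i = h x" if "x < m" for x
    using h(2) that inv_into_into[of "h x" "\<lambda>j. row_coloring c j i" "{..<n}"]
      f_inv_into_f[of "h x" "\<lambda>j. row_coloring c j i" "{..<n}"] by auto
  show ?thesis
  proof (rule contains_rainbow_star[of "\<lambda>j. Inl (?g j)" _ "Inr i"])
    show "inj_on (\<lambda>j. Inl (?g j)) {..<m}"
      using g(2) h(1) unfolding inj_on_def by (metis lessThan_iff sum.inject(1))
    show "inj_on (\<lambda>j. c {Inr i, Inl (?g j)}) {..<m}"
      using g(2) h(1) unfolding inj_on_def row_coloring_def by (auto simp: insert_commute)
  qed (use g assms(1) in \<open>auto simp: complete_bipartite_def insert_commute\<close>)
qed

section \<open>Every exact coloring contains one of the two required subgraphs\<close>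

lemma row_coloring_colors:
  assumes "exact_coloring k (complete_bipartite n n) c"
  shows "(\<Union>i<n. row_coloring c i ` {..<n}) = {1..k}"
proof -
  have "(\<Union>i<n. row_coloring c i ` {..<n}) = (\<lambda>(i, j). row_coloring c i j) ` ({..<n} \<times> {..<n})"
    by (fastforce simp: image_iff)
  also have "\<dots> = c ` edges (complete_bipartite n n)"
    unfolding edges_complete_bipartite image_image row_coloring_def by (simp add: case_prod_beta)
  finally show ?thesis using assms by (simp add: exact_coloring_def)
qed

lemma rainbow_star_or_mono:
  assumes "exact_coloring k (complete_bipartite n n) c" "5 \<le> k"
    and "subgraph F0 (star (k div 2))" "graph_iso F0 H"
  shows "contains_rainbow n c (star 3) \<or> contains_mono n c H"
  unfolding disj_imp
proof
  assume "\<not> contains_rainbow n c (star 3)"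
  then have "mono_star (k div 2) n (row_coloring c)"
    using contains_rainbow_star_if_many_colors[of _ n 3 c] row_coloring_colors[OF assms(1)] assms(2)
    by (intro mono_star_if_no_rainbow_claw) (force simp: not_le)+
  then show "contains_mono n c H" using contains_mono_if_mono_star assms by blast
qed

lemma rainbow_path_or_mono:
  assumes "exact_coloring k (complete_bipartite n n) c" "5 \<le> k"
    and "subgraph F0 (star (k div 2))" "graph_iso F0 H"
  shows "contains_rainbow n c (path_graph 5) \<or> contains_mono n c H"
  unfolding disj_imp
proof
  let ?f = "row_coloring c"
  assume "\<not> contains_rainbow n c (path_graph 5)"
  note np = no_rainbow_path_row_coloring[OF this]
  note colors = row_coloring_colors[OF assms(1)]
  have colors': "(\<Union>j<n. (\<lambda>i. ?f i j) ` {..<n}) = {1..k}" using colors by blast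
  \<comment> \<open>Three colors occur in some row, in some column, or at no vertex. The second case
    is the first for the transposed array, and the third is the situation without a rainbow
    claw.\<close>
  consider u where "u < n" "3 \<le> card (?f u ` {..<n})"
    | u where "u < n" "3 \<le> card ((\<lambda>i. ?f i u) ` {..<n})"
    | "\<And>u. u < n \<Longrightarrow> card (?f u ` {..<n}) \<le> 2" "\<And>u. u < n \<Longrightarrow> card ((\<lambda>i. ?f i u) ` {..<n}) \<le> 2"
    by (metis not_less_eq_eq numeral_2_eq_2 numeral_3_eq_3)
  then have "mono_star (k div 2) n ?f \<or> mono_star (k div 2) n (\<lambda>j i. ?f i j)"
  proof cases
    case 1
    then show ?thesis using mono_star_if_rainbow_claw[OF np(1) _ _ colors] assms(2) by blast
  next
    case 2
    then show ?thesis using mono_star_if_rainbow_claw[OF np(2) _ _ colors'] assms(2) by blast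
  next
    case 3
    then show ?thesis using mono_star_if_no_rainbow_claw[OF _ _ colors] assms(2) by blast
  qed
  then show "contains_mono n c H" using contains_mono_if_mono_star assms by blast
qed


section \<open>The number of colors\<close>

lemma card_edges_complete_bipartite: "card (edges (complete_bipartite m n)) = m * n"
proof -
  have "inj_on (\<lambda>(i, j). {Inl i, Inr j}) ({..<m} \<times> {..<n})"
    by (auto simp: inj_on_def doubleton_eq_iff)
  then show ?thesis by (simp add: edges_complete_bipartite card_image)
qed

lemma exact_coloring_exists_iff:
  assumes "1 \<le> k"
  shows "(\<exists>c. exact_coloring k (complete_bipartite n n) c) \<longleftrightarrow> k \<le> n * n"
proof
  have fin: "finite (edges (complete_bipartite n n))" by (simp add: edges_complete_bipartite)
  {
    assume "\<exists>c. exact_coloring k (complete_bipartite n n) c"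
    then show "k \<le> n * n"
      unfolding exact_coloring_def
      using card_image_le[OF fin] by (metis card_atLeastAtMost card_edges_complete_bipartite diff_Suc_1)
  next
    assume k: "k \<le> n * n"
    obtain h where h: "bij_betw h (edges (complete_bipartite n n)) {1..n * n}"
      using finite_same_card_bij[OF fin, of "{1..n * n}"] by (auto simp: card_edges_complete_bipartite)
    \<comment> \<open>Number the edges from 1 to \<open>n * n\<close> and give color
      \<open>k\<close> to every edge numbered above \<open>k\<close>.\<close>
    have "(\<lambda>e. min k (h e)) ` edges (complete_bipartite n n) = min k ` {1..n * n}"
      using h by (auto simp: bij_betw_def image_image[symmetric])
    also have "\<dots> = {1..k}"
    proof (intro equalityI subsetI)
      fix x assume "x \<in> {1..k}"
      then show "x \<in> min k ` {1..n * n}" using k by (intro image_eqI[of _ _ x]) auto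
    qed (use assms in auto)
    finally show "\<exists>c. exact_coloring k (complete_bipartite n n) c"
      unfolding exact_coloring_def by blast
  }
qed

lemma ceiling_sqrt_le_iff: "nat \<lceil>sqrt (real k)\<rceil> \<le> n \<longleftrightarrow> k \<le> n * n"
proof -
  have "nat \<lceil>sqrt (real k)\<rceil> \<le> n \<longleftrightarrow> sqrt (real k) \<le> real n" by linarith
  also have "\<dots> \<longleftrightarrow> real k \<le> (real n)\<^sup>2" 
    by (metis of_nat_0_le_iff real_le_lsqrt sqrt_le_D)
  also have "\<dots> \<longleftrightarrow> k \<le> n * n" by (metis of_nat_le_iff of_nat_mult power2_eq_square)
  finally show ?thesis .
qed

text \<open>Since every exact coloring has a required subgraph, \<open>N\<close> is a bound exactly
  when exact colorings exist for all \<open>n \<ge> N\<close>. As \<open>n * n\<close> is monotone,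
  this only asks for \<open>k \<le> N * N\<close>.\<close>

lemma bgr_eq_ceiling_sqrt:
  assumes "1 \<le> k"
    and "\<And>n c. exact_coloring k (complete_bipartite n n) c
           \<Longrightarrow> contains_rainbow n c G \<or> contains_mono n c H"
  shows "bgr k G H = enat (nat \<lceil>sqrt (real k)\<rceil>)"
proof -
  have "bgr_bound k G H N \<longleftrightarrow> nat \<lceil>sqrt (real k)\<rceil> \<le> N" for N
  proof -
    have "bgr_bound k G H N \<longleftrightarrow> (\<forall>n\<ge>N. k \<le> n * n)"
      unfolding bgr_bound_def exact_coloring_exists_iff[OF assms(1)]
      using assms(2) unfolding contains_rainbow_def contains_mono_def by blast
    then show ?thesis unfolding ceiling_sqrt_le_iff by (meson le_trans mult_le_mono order_refl)
  qed
  then have "bgr k G H = Inf {enat N | N. nat \<lceil>sqrt (real k)\<rceil> \<le> N}"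
    by (simp add: bgr_def)
  also have "\<dots> = enat (nat \<lceil>sqrt (real k)\<rceil>)"
    by (intro antisym Inf_lower Inf_greatest) auto
  finally show ?thesis .
qed

text \<open>For odd \<open>k\<close> the quotient is already \<open>k div 2\<close>; for even
  \<open>k\<close> it falls short of it by one half.\<close>

lemma ceiling_half_pred: "nat \<lceil>(real k - 1) / 2\<rceil> = k div 2"
proof -
  have "\<lceil>(real k - 1) / 2\<rceil> = int (k div 2)"
    by (rule ceiling_unique) (cases "even k"; auto elim!: evenE oddE)+
  then show ?thesis by simp
qed

theorem theorem4p4:
  fixes k :: nat and H :: "'a graph"
  assumes "k \<ge> 5"
    and "simple_graph H" and "no_isolated H" and "edges H \<noteq> {}"
    and "\<exists>F. subgraph F (star (nat \<lceil>(real k - 1) / 2\<rceil>)) \<and> graph_iso F H"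
  shows "bgr k (path_graph 5) H = enat (nat \<lceil>sqrt (real k)\<rceil>) \<and>
         bgr k (star 3) H = enat (nat \<lceil>sqrt (real k)\<rceil>)"
proof -
  obtain F0 where F0: "subgraph F0 (star (k div 2))" "graph_iso F0 H"
    using assms(5) unfolding ceiling_half_pred by blast
  show ?thesis
    using assms(1) rainbow_path_or_mono[OF _ _ F0] rainbow_star_or_mono[OF _ _ F0]
    by (intro conjI bgr_eq_ceiling_sqrt) auto
qed

end
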